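(* Let $1<p<2$. There do not exist constants $K\ge1$ and $C>0$ such that for every finite dyadic tree $T$, all functions $f,g:T\to[0,\infty)$ and all numbers $\delta,\lambda>0$ with $\lambda\ge K\delta$ satisfying (i) $\operatorname{supp} f\subseteq\{Ig\le\delta\}$, (ii) $g$ is superadditive, (iii) $Ig\le\lambda$ on $T$, one has $$\|If\cdot g\|_{\ell^p(T)}\le C\,\delta^{\frac{p-1}{p}}\lambda^{\frac1p}\|f\|_{\ell^p(T)}.$$
   Context: A finite dyadic tree $T$ is the set of dyadic subintervals of $[0,1]$ of the first finitely many generations (generations $0,\dots,N$), ordered by inclusion: $\alpha\le\beta$ iff $\alpha\subseteq\beta$; the children of a non-leaf $\beta$ are its two dyadic halves. The Hardy operator is $Ih(\alpha)=\sum_{\alpha'\ge\alpha}h(\alpha')$ for $h:T\to[0,\infty)$. A function $g:T\to[0,\infty)$ is superadditive if $g(\beta)\ge\sum_{\beta'\in\mathrm{ch}(\beta)}g(\beta')$ for every $\beta\in T$, where $\mathrm{ch}(\beta)$ is the set of children of $\beta$ (empty for a leaf). $\|h\|_{\ell^p(T)}=(\sum_{\alpha\in T}|h(\alpha)|^p)^{1/p}$. *)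

theory Defs
  imports Complex_Main "HOL-Library.FuncSet"
begin

definition dyadic_interval :: "nat \<Rightarrow> nat \<Rightarrow> real set" where
  "dyadic_interval n k = {real k / 2 ^ n .. (real k + 1) / 2 ^ n}"

text \<open>The nodes are the intervals themselves, so the order of the tree is \<open>\<subseteq>\<close>.
  Functions on the tree are total functions on \<open>real set\<close>; only their values on
  \<open>dyadic_tree N\<close> are ever used.\<close>

definition dyadic_tree :: "nat \<Rightarrow> real set set" where
  "dyadic_tree N = {dyadic_interval n k | n k. n \<le> N \<and> k < 2 ^ n}"

text \<open>Intersecting with \<open>dyadic_tree N\<close> makes the set of children of a leaf empty.\<close>

definition dyadic_children :: "nat \<Rightarrow> real set \<Rightarrow> real set set" where
  "dyadic_children N \<beta> =
     {\<beta>' \<in> dyadic_tree N. \<exists>n k. \<beta> = dyadic_interval n k \<and>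
        (\<beta>' = dyadic_interval (Suc n) (2 * k) \<or> \<beta>' = dyadic_interval (Suc n) (2 * k + 1))}"

definition hardy :: "nat \<Rightarrow> (real set \<Rightarrow> real) \<Rightarrow> real set \<Rightarrow> real" where
  "hardy N h \<alpha> = (\<Sum>\<alpha>' \<in> {\<alpha>' \<in> dyadic_tree N. \<alpha> \<subseteq> \<alpha>'}. h \<alpha>')"

definition superadditive :: "nat \<Rightarrow> (real set \<Rightarrow> real) \<Rightarrow> bool" where
  "superadditive N g \<longleftrightarrow>
     (\<forall>\<beta> \<in> dyadic_tree N. (\<Sum>\<beta>' \<in> dyadic_children N \<beta>. g \<beta>') \<le> g \<beta>)"

definition tree_lp_norm :: "nat \<Rightarrow> real \<Rightarrow> (real set \<Rightarrow> real) \<Rightarrow> real" where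
  "tree_lp_norm N p h = (\<Sum>\<alpha> \<in> dyadic_tree N. \<bar>h \<alpha>\<bar> powr p) powr (1 / p)"

end

(* The counterexample has delta = 1 and f the indicator of the root, so that If = 1 on the whole tree.
   The function g halves at each of the first m generations; below generation m the 2^m masses 2^(-m)
   travel without further splitting down the leftmost branches for M = q * 2^m generations, q >= K. The path
   sums of g are at most q + 2, whereas the sum of g^p is at least
   M * 2^m * 2^(-mp) = q * 2^(m(2-p)), which is unbounded in m because p < 2. *)
theory Submission
  imports Defs
begin

text \<open>The length \<open>1 / 2 ^ n\<close> fixes the generation, and then the left endpoint
  fixes the index. This lets functions on the tree, whose nodes are sets, be given through index
  pairs.\<close>

lemma dyadic_interval_eq_iff [simp]:
  "dyadic_interval n k = dyadic_interval n' k' \<longleftrightarrow> n = n' \<and> k = k'"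
proof
  assume "dyadic_interval n k = dyadic_interval n' k'"
  then have l: "real k / 2 ^ n = real k' / 2 ^ n'" and r: "(real k + 1) / 2 ^ n = (real k' + 1) / 2 ^ n'"
    by (auto simp: dyadic_interval_def Icc_eq_Icc divide_right_mono)
  then have "1 / (2::real) ^ n = 1 / 2 ^ n'"
    by (simp add: add_divide_distrib)
  then have "n = n'" by simp
  with l show "n = n' \<and> k = k'" by simp
qed simp

text \<open>The left endpoint of the smaller interval lies in exactly one half-open interval of
  generation \<open>i\<close>. Hence a node has at most one ancestor in each generation.\<close>

lemma dyadic_interval_subset_imp:
  assumes "dyadic_interval n k \<subseteq> dyadic_interval i j"
  shows "j = nat \<lfloor>real k * 2 ^ i / 2 ^ n\<rfloor>"
proof -
  have "real k / 2 ^ n \<le> (real k + 1) / 2 ^ n"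
    by (simp add: divide_right_mono)
  with assms have l: "real j / 2 ^ i \<le> real k / 2 ^ n" and r: "(real k + 1) / 2 ^ n \<le> (real j + 1) / 2 ^ i"
    by (auto simp: dyadic_interval_def)
  \<comment> \<open>Positive length gives the strict upper bound that pins down the floor.\<close>
  have "real k / 2 ^ n < (real k + 1) / 2 ^ n"
    by (simp add: divide_strict_right_mono)
  with r have "real k / 2 ^ n < (real j + 1) / 2 ^ i"
    by linarith
  with l have "real j \<le> real k * 2 ^ i / 2 ^ n" "real k * 2 ^ i / 2 ^ n < real j + 1"
    by (simp_all add: field_simps)
  then have "\<lfloor>real k * 2 ^ i / 2 ^ n\<rfloor> = int j"
    by (intro floor_unique) auto
  then show ?thesis by simp
qed

lemma finite_dyadic_tree [simp]: "finite (dyadic_tree N)"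
proof -
  have "dyadic_tree N = (\<Union>n\<le>N. dyadic_interval n ` {..<2 ^ n})"
    by (auto simp: dyadic_tree_def)
  then show ?thesis by simp
qed

lemma dyadic_tree_subset_root:
  assumes "\<alpha> \<in> dyadic_tree N"
  shows "\<alpha> \<subseteq> dyadic_interval 0 0"
proof -
  obtain n k where \<alpha>: "\<alpha> = dyadic_interval n k" and "k < 2 ^ n"
    using assms by (auto simp: dyadic_tree_def)
  then have "real (Suc k) \<le> real (2 ^ n)"
    by (intro of_nat_mono) simp
  then have "(real k + 1) / 2 ^ n \<le> 1"
    by simp
  moreover have "0 \<le> real k / 2 ^ n" by simp
  ultimately show ?thesis
    unfolding \<alpha> dyadic_interval_def by auto
qed

lemma root_in_dyadic_tree [simp]: "dyadic_interval 0 0 \<in> dyadic_tree N"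
  by (force simp: dyadic_tree_def)

lemma hardy_indicator_root:
  assumes "\<alpha> \<in> dyadic_tree N"
  shows "hardy N (\<lambda>\<beta>. if \<beta> = dyadic_interval 0 0 then 1 else 0) \<alpha> = 1"
  using dyadic_tree_subset_root[OF assms] by (simp add: hardy_def)

text \<open>The path above a node meets each generation at most once, so a path sum is controlled by
  one bound per generation.\<close>

lemma hardy_le_sum_bounds:
  assumes "\<alpha> \<in> dyadic_tree N"
    and nonneg: "\<And>\<beta>. 0 \<le> g \<beta>"
    and le: "\<And>i j. g (dyadic_interval i j) \<le> b i"
  shows "hardy N g \<alpha> \<le> (\<Sum>i\<le>N. b i)"
proof -
  obtain n k where \<alpha>: "\<alpha> = dyadic_interval n k"
    using assms by (auto simp: dyadic_tree_def)
  let ?A = "\<lambda>i. dyadic_interval i (nat \<lfloor>real k * 2 ^ i / 2 ^ n\<rfloor>)"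
  have "{\<alpha>' \<in> dyadic_tree N. \<alpha> \<subseteq> \<alpha>'} \<subseteq> ?A ` {..N}"
  proof
    fix \<alpha>' assume "\<alpha>' \<in> {\<alpha>' \<in> dyadic_tree N. \<alpha> \<subseteq> \<alpha>'}"
    then obtain i j where "\<alpha>' = dyadic_interval i j" "i \<le> N" "dyadic_interval n k \<subseteq> dyadic_interval i j"
      unfolding \<alpha> dyadic_tree_def by blast
    then have "\<alpha>' = ?A i" "i \<in> {..N}"
      by (simp_all only: dyadic_interval_subset_imp[of n k i j, symmetric] atMost_iff)
    then show "\<alpha>' \<in> ?A ` {..N}"
      by (rule image_eqI)
  qed
  \<comment> \<open>For \<open>i > n\<close> the interval \<open>?A i\<close> is no ancestor; such
    extra terms are harmless because \<open>g\<close> is nonnegative.\<close>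
  then have "hardy N g \<alpha> \<le> sum g (?A ` {..N})"
    unfolding hardy_def by (intro sum_mono2) (auto simp: nonneg)
  also have "\<dots> \<le> (\<Sum>i\<le>N. g (?A i))"
    using sum_image_le[of "{..N}" g ?A] nonneg by (simp add: o_def)
  also have "\<dots> \<le> (\<Sum>i\<le>N. b i)"
    by (intro sum_mono le)
  finally show ?thesis .
qed

text \<open>The children always lie among the two halves, and a leaf has none; nonnegativity
  therefore reduces every node to one inequality in indices.\<close>

lemma superadditiveI:
  assumes nonneg: "\<And>\<beta>. 0 \<le> g \<beta>"
    and le: "\<And>n k. g (dyadic_interval (Suc n) (2 * k)) + g (dyadic_interval (Suc n) (2 * k + 1))
                    \<le> g (dyadic_interval n k)"
  shows "superadditive N g"
  unfolding superadditive_def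
proof
  fix \<beta> assume "\<beta> \<in> dyadic_tree N"
  then obtain n k where \<beta>: "\<beta> = dyadic_interval n k"
    by (auto simp: dyadic_tree_def)
  let ?P = "{dyadic_interval (Suc n) (2 * k), dyadic_interval (Suc n) (2 * k + 1)}"
  have "sum g (dyadic_children N \<beta>) \<le> sum g ?P"
    by (intro sum_mono2) (auto simp: dyadic_children_def \<beta> nonneg)
  also have "\<dots> \<le> g \<beta>"
    using le[of n k] by (simp add: \<beta>)
  finally show "sum g (dyadic_children N \<beta>) \<le> g \<beta>" .
qed

text \<open>The description is unique by \<open>dyadic_interval_eq_iff\<close>. The value 0 on other
  sets keeps the function nonnegative everywhere, as the lemmas above require.\<close>

definition dyadic_fun :: "(nat \<Rightarrow> nat \<Rightarrow> real) \<Rightarrow> real set \<Rightarrow> real" where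
  "dyadic_fun G \<alpha> = (if \<exists>n k. \<alpha> = dyadic_interval n k
     then THE x. \<exists>n k. \<alpha> = dyadic_interval n k \<and> x = G n k else 0)"

lemma dyadic_fun_interval [simp]: "dyadic_fun G (dyadic_interval n k) = G n k"
  by (auto simp: dyadic_fun_def)

lemma dyadic_fun_nonneg: "(\<And>n k. 0 \<le> G n k) \<Longrightarrow> 0 \<le> dyadic_fun G \<alpha>"
  by (cases "\<exists>n k. \<alpha> = dyadic_interval n k") (auto, simp add: dyadic_fun_def)

text \<open>For \<open>n \<le> m\<close> the truncated exponent \<open>n - m\<close> is \<open>0\<close> and the divisibility condition is void.\<close>

definition branching_mass :: "nat \<Rightarrow> nat \<Rightarrow> nat \<Rightarrow> real" where
  "branching_mass m n k = (if 2 ^ (n - m) dvd k then (1 / 2) ^ min n m else 0)"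

lemma branching_mass_nonneg: "0 \<le> branching_mass m n k"
  by (simp add: branching_mass_def)

lemma branching_mass_le: "branching_mass m n k \<le> (1 / 2) ^ min n m"
  by (simp add: branching_mass_def)

text \<open>Before generation \<open>m\<close> both halves get half of the mass. From generation
  \<open>m\<close> on, the left half keeps the whole mass and the right half gets none.\<close>

lemma branching_mass_children:
  "branching_mass m (Suc n) (2 * k) + branching_mass m (Suc n) (2 * k + 1) \<le> branching_mass m n k"
proof (cases "n < m")
  case True
  then show ?thesis by (simp add: branching_mass_def min_def)
next
  case False
  then have "(2::nat) ^ (Suc n - m) = 2 * 2 ^ (n - m)"
    by (simp add: Suc_diff_le)
  \<comment> \<open>The right half has an odd index, which an even number cannot divide.\<close>
  moreover have "\<not> 2 * 2 ^ (n - m) dvd Suc (2 * k)"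
    by (metis dvd_mult_left even_Suc even_mult_iff dvd_refl)
  ultimately show ?thesis
    using False by (simp add: branching_mass_def min_def)
qed

text \<open>A geometric series up to generation \<open>m\<close>, followed by \<open>M\<close> equal
  terms.\<close>

lemma sum_half_power_min:
  "(\<Sum>i\<le>m + M. (1 / 2 :: real) ^ min i m) = 2 - (1 / 2) ^ m + real M * (1 / 2) ^ m"
proof (induction M)
  case 0
  have "(\<Sum>i\<le>m. (1 / 2 :: real) ^ min i m) = (\<Sum>i\<le>m. (1 / 2) ^ i)"
    by (intro sum.cong) auto
  also have "\<dots> = 2 - (1 / 2) ^ m"
    by (induction m) auto
  finally show ?case by simp
next
  case (Suc M)
  then show ?case by (simp add: algebra_simps)
qed

text \<open>Only the nodes carrying mass below generation \<open>m\<close> are kept: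
  \<open>2 ^ m\<close> of them in each of \<open>M\<close> generations, all of mass
  \<open>(1 / 2) ^ m\<close>.\<close>

lemma sum_branching_mass_powr_ge:
  "real M * 2 ^ m * ((1 / 2) ^ m) powr p
     \<le> (\<Sum>\<alpha>\<in>dyadic_tree (m + M). \<bar>dyadic_fun (branching_mass m) \<alpha>\<bar> powr p)"
proof -
  let ?h = "\<lambda>\<alpha>. \<bar>dyadic_fun (branching_mass m) \<alpha>\<bar> powr p"
  let ?I = "{m<..m + M} \<times> {..<2 ^ m :: nat}"
  \<comment> \<open>The leftmost descendant in generation \<open>i\<close> of the
    \<open>j\<close>-th interval of generation \<open>m\<close>.\<close>
  let ?D = "\<lambda>(i, j). dyadic_interval i (j * 2 ^ (i - m))"
  have inj: "inj_on ?D ?I"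
    by (auto simp: inj_on_def)
  have sub: "?D ` ?I \<subseteq> dyadic_tree (m + M)"
  proof clarsimp
    fix i j assume "m < i" "i \<le> m + M" "j < (2::nat) ^ m"
    then have "j * 2 ^ (i - m) < 2 ^ m * 2 ^ (i - m)"
      by simp
    also have "\<dots> = (2::nat) ^ i"
      using \<open>m < i\<close> by (simp flip: power_add)
    finally show "dyadic_interval i (j * 2 ^ (i - m)) \<in> dyadic_tree (m + M)"
      using \<open>i \<le> m + M\<close> by (auto simp: dyadic_tree_def)
  qed
  have "real M * 2 ^ m * ((1 / 2) ^ m) powr p = (\<Sum>x\<in>?I. ((1 / 2) ^ m) powr p)"
    by simp
  also have "\<dots> = (\<Sum>x\<in>?I. ?h (?D x))"
    by (intro sum.cong) (auto simp: branching_mass_def)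
  also have "\<dots> = sum ?h (?D ` ?I)"
    by (simp add: sum.reindex[OF inj])
  also have "\<dots> \<le> sum ?h (dyadic_tree (m + M))"
    using sub by (intro sum_mono2) auto
  finally show ?thesis .
qed

theorem mainTheorem2:
  fixes p :: real
  assumes "1 < p" and "p < 2"
  shows "\<not> (\<exists>K C :: real. K \<ge> 1 \<and> C > 0 \<and>
    (\<forall>(N :: nat) (f :: real set \<Rightarrow> real) (g :: real set \<Rightarrow> real) (\<delta> :: real) (L :: real).
       f \<in> dyadic_tree N \<rightarrow> {0..} \<longrightarrow>
       g \<in> dyadic_tree N \<rightarrow> {0..} \<longrightarrow>
       \<delta> > 0 \<longrightarrow> L > 0 \<longrightarrow> L \<ge> K * \<delta> \<longrightarrow>
       {\<alpha> \<in> dyadic_tree N. f \<alpha> \<noteq> 0} \<subseteq> {\<alpha> \<in> dyadic_tree N. hardy N g \<alpha> \<le> \<delta>} \<longrightarrow>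
       superadditive N g \<longrightarrow>
       (\<forall>\<alpha> \<in> dyadic_tree N. hardy N g \<alpha> \<le> L) \<longrightarrow>
       tree_lp_norm N p (\<lambda>\<alpha>. hardy N f \<alpha> * g \<alpha>)
         \<le> C * \<delta> powr ((p - 1) / p) * L powr (1 / p) * tree_lp_norm N p f))"
proof (rule notI, elim exE conjE)
  fix K C :: real
  assume K: "K \<ge> 1" and C: "C > 0"
    and *: "\<forall>(N :: nat) (f :: real set \<Rightarrow> real) (g :: real set \<Rightarrow> real) (\<delta> :: real) (L :: real).
       f \<in> dyadic_tree N \<rightarrow> {0..} \<longrightarrow>
       g \<in> dyadic_tree N \<rightarrow> {0..} \<longrightarrow>
       \<delta> > 0 \<longrightarrow> L > 0 \<longrightarrow> L \<ge> K * \<delta> \<longrightarrow>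
       {\<alpha> \<in> dyadic_tree N. f \<alpha> \<noteq> 0} \<subseteq> {\<alpha> \<in> dyadic_tree N. hardy N g \<alpha> \<le> \<delta>} \<longrightarrow>
       superadditive N g \<longrightarrow>
       (\<forall>\<alpha> \<in> dyadic_tree N. hardy N g \<alpha> \<le> L) \<longrightarrow>
       tree_lp_norm N p (\<lambda>\<alpha>. hardy N f \<alpha> * g \<alpha>)
         \<le> C * \<delta> powr ((p - 1) / p) * L powr (1 / p) * tree_lp_norm N p f"
  obtain q :: nat where q: "K \<le> real q"
    using real_arch_simple by blast
  define L where "L = real q + 2"
  have "1 < 2 powr (2 - p)"
    using assms by simp
  \<comment> \<open>Possible because \<open>L\<close> depends on \<open>q\<close> alone, so that
    \<open>m\<close> can be chosen after it.\<close>
  then obtain m where m: "C powr p * L < (2 powr (2 - p)) ^ m"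
    using real_arch_pow by blast
  \<comment> \<open>The \<open>M\<close> lower generations add at most
    \<open>M * (1 / 2) ^ m = q\<close> to a path sum, whatever \<open>m\<close> is.\<close>
  define M where "M = q * 2 ^ m"
  define N where "N = m + M"
  define f :: "real set \<Rightarrow> real" where "f = (\<lambda>\<beta>. if \<beta> = dyadic_interval 0 0 then 1 else 0)"
  define g where "g = dyadic_fun (branching_mass m)"
  have g_nonneg: "0 \<le> g \<beta>" for \<beta>
    unfolding g_def by (intro dyadic_fun_nonneg branching_mass_nonneg)
  \<comment> \<open>With \<open>f\<close> supported at the root, this is all that the support
    condition asks for at \<delta> = 1.\<close>
  have root: "hardy N g (dyadic_interval 0 0) \<le> 1"
  proof -
    have "{\<alpha> \<in> dyadic_tree N. dyadic_interval 0 0 \<subseteq> \<alpha>} = {dyadic_interval 0 0}"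
      using dyadic_tree_subset_root by force
    then show ?thesis
      by (simp add: hardy_def g_def branching_mass_def)
  qed
  have bound: "hardy N g \<alpha> \<le> L" if "\<alpha> \<in> dyadic_tree N" for \<alpha>
  proof -
    have "hardy N g \<alpha> \<le> (\<Sum>i\<le>N. (1 / 2) ^ min i m)"
      using that g_nonneg by (rule hardy_le_sum_bounds) (simp add: g_def branching_mass_le)
    also have "\<dots> = 2 - (1 / 2) ^ m + real M * (1 / 2) ^ m"
      unfolding N_def by (rule sum_half_power_min)
    also have "\<dots> = 2 - (1 / 2) ^ m + real q"
      by (simp add: M_def power_one_over)
    also have "\<dots> \<le> L"
      by (simp add: L_def)
    finally show ?thesis .
  qed
  have "superadditive N g"
    using g_nonneg by (rule superadditiveI) (use branching_mass_children in \<open>simp add: g_def\<close>)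
  moreover have "{\<alpha> \<in> dyadic_tree N. f \<alpha> \<noteq> 0} \<subseteq> {\<alpha> \<in> dyadic_tree N. hardy N g \<alpha> \<le> 1}"
    using root by (auto simp: f_def split: if_splits)
  moreover have "L > 0" "L \<ge> K * 1"
    using q by (auto simp: L_def)
  moreover have "f \<in> dyadic_tree N \<rightarrow> {0..}" "g \<in> dyadic_tree N \<rightarrow> {0..}"
    using g_nonneg by (auto simp: f_def)
  ultimately have "tree_lp_norm N p (\<lambda>\<alpha>. hardy N f \<alpha> * g \<alpha>)
      \<le> C * 1 powr ((p - 1) / p) * L powr (1 / p) * tree_lp_norm N p f"
    using bound by (intro *[rule_format]) auto
  moreover have "tree_lp_norm N p f = 1"
  proof -
    have "(\<Sum>\<alpha>\<in>dyadic_tree N. \<bar>f \<alpha>\<bar> powr p) = (\<Sum>\<alpha>\<in>dyadic_tree N. if \<alpha> = dyadic_interval 0 0 then 1 else 0)"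
      by (intro sum.cong) (auto simp: f_def)
    then show ?thesis
      by (simp add: tree_lp_norm_def)
  qed
  moreover define S where "S = (\<Sum>\<alpha>\<in>dyadic_tree N. \<bar>g \<alpha>\<bar> powr p)"
  have "tree_lp_norm N p (\<lambda>\<alpha>. hardy N f \<alpha> * g \<alpha>) = S powr (1 / p)"
    by (simp add: tree_lp_norm_def S_def f_def hardy_indicator_root)
  ultimately have "S powr (1 / p) \<le> C * L powr (1 / p)"
    by simp
  then have "(S powr (1 / p)) powr p \<le> (C * L powr (1 / p)) powr p"
    using assms by (intro powr_mono2) auto
  moreover have "0 \<le> S"
    unfolding S_def by (intro sum_nonneg) simp
  ultimately have upper: "S \<le> C powr p * L"
    using assms C \<open>L > 0\<close> by (simp add: powr_powr powr_mult)
  \<comment> \<open>Here \<open>q\<close> is at least 1, since \<open>K\<close> is.\<close>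
  have "(2 powr (2 - p)) ^ m \<le> real q * (2 powr (2 - p)) ^ m"
    using q K by simp
  also have "\<dots> = real M * 2 ^ m * ((1 / 2) ^ m) powr p"
  proof -
    \<comment> \<open>One factor \<open>2 ^ m\<close> belongs to \<open>M\<close>, the other counts
      the branches.\<close>
    have "(2 powr (2 - p)) ^ m = 2 powr (real m + real m + - (real m * p))"
      by (simp add: powr_power algebra_simps)
    also have "\<dots> = 2 ^ m * 2 ^ m * 2 powr (- (real m * p))"
      unfolding powr_add by (simp add: powr_realpow)
    also have "2 powr (- (real m * p)) = ((1 / 2) ^ m) powr p"
    proof -
      have "(1 / 2 :: real) ^ m = 2 powr (- real m)"
        by (simp add: powr_minus_divide powr_realpow power_one_over)
      then show ?thesis
        by (simp add: powr_powr)
    qed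
    finally show ?thesis
      by (simp add: M_def)
  qed
  also have "\<dots> \<le> S"
    unfolding S_def N_def g_def by (rule sum_branching_mass_powr_ge)
  finally show False
    using upper m by simp
qed

end
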